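(* For each positive integer $n$ there is a function $f_n$ that is simple of order $n$ and such that $h:=f_n^2$ is simple of order $\frac{n(n+1)}{2}$. Indeed, an example of such a function is $$f_n(x):=\sum_{k=1}^{n}e^{x^k}.$$
   Context: Let $K$ be one of $\mathbb{Q},\mathbb{R},\mathbb{C}$. A homogeneous linear ordinary differential equation $\sum_{k=0}^{N}p_k(x)\,y^{(k)}(x)=0$ whose coefficients $p_k$ are polynomials in $x$ over $K$, with $p_N\not\equiv 0$, is called a simple differential equation of order $N$. A function satisfying some simple differential equation is called simple; its order is the least order of a simple differential equation that it satisfies. *)

theory Defs
  imports "HOL-Analysis.Analysis" "HOL-Computational_Algebra.Polynomial"
begin

text \<open>
  The coefficient field \<open>K\<close> is represented as a subset of the field \<open>'a\<close> (\<^typ>\<open>real\<close> or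
  \<^typ>\<open>complex\<close>) in which the functions take their values.  The equation
  \<open>p 0 * y + p 1 * y' + ... + p N * y^(N) = 0\<close> is encoded by \<open>N\<close> and \<open>p\<close>;
  the values \<open>p k\<close> for \<open>k > N\<close> are irrelevant.
\<close>

definition simple_diff_eq :: "'a::real_normed_field set \<Rightarrow> nat \<Rightarrow> (nat \<Rightarrow> 'a poly) \<Rightarrow> bool"
  where "simple_diff_eq K N p \<longleftrightarrow> (\<forall>k\<le>N. \<forall>i. coeff (p k) i \<in> K) \<and> p N \<noteq> 0"

text \<open>
  The set \<open>S\<close> is the domain of the function and is meant to be nonempty, open and connected.
  As \<^const>\<open>deriv\<close> is a total operator, the existence of the derivatives up to
  order \<open>N\<close> has to be demanded explicitly.
\<close>

definition solves_diff_eq ::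
    "'a::real_normed_field set \<Rightarrow> ('a \<Rightarrow> 'a) \<Rightarrow> nat \<Rightarrow> (nat \<Rightarrow> 'a poly) \<Rightarrow> bool"
  where "solves_diff_eq S f N p \<longleftrightarrow>
    (\<forall>x\<in>S. (\<forall>k<N. (deriv ^^ k) f field_differentiable at x) \<and>
           (\<Sum>k\<le>N. poly (p k) x * (deriv ^^ k) f x) = 0)"

definition satisfies_simple_of_order ::
    "'a::real_normed_field set \<Rightarrow> 'a set \<Rightarrow> ('a \<Rightarrow> 'a) \<Rightarrow> nat \<Rightarrow> bool"
  where "satisfies_simple_of_order K S f N \<longleftrightarrow>
    (\<exists>p. simple_diff_eq K N p \<and> solves_diff_eq S f N p)"

definition simple_fun :: "'a::real_normed_field set \<Rightarrow> 'a set \<Rightarrow> ('a \<Rightarrow> 'a) \<Rightarrow> bool"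
  where "simple_fun K S f \<longleftrightarrow> (\<exists>N. satisfies_simple_of_order K S f N)"

definition simple_order :: "'a::real_normed_field set \<Rightarrow> 'a set \<Rightarrow> ('a \<Rightarrow> 'a) \<Rightarrow> nat"
  where "simple_order K S f = (LEAST N. satisfies_simple_of_order K S f N)"

text \<open>
  The first conjunct is needed because \<^const>\<open>simple_order\<close> is unspecified for functions that
  are not simple.
\<close>

definition simple_of_order ::
    "'a::real_normed_field set \<Rightarrow> 'a set \<Rightarrow> ('a \<Rightarrow> 'a) \<Rightarrow> nat \<Rightarrow> bool"
  where "simple_of_order K S f n \<longleftrightarrow> simple_fun K S f \<and> simple_order K S f = n"

definition exp_power_sum :: "nat \<Rightarrow> 'a::{real_normed_field,banach} \<Rightarrow> 'a"
  where "exp_power_sum n x = (\<Sum>k=1..n. exp (x ^ k))"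

end

theory Submission imports Defs begin

text \<open>
  Both the sum of the exponentials \<open>exp (x ^ k)\<close> and its square are exponential polynomials
  \<open>f = (\<Sum>j\<in>I. u j * exp (q j))\<close>, where the \<open>u j\<close> and \<open>q j\<close> are polynomials over \<open>K\<close>, the
  \<open>u j\<close> are nonzero, and no two of the exponents \<open>q j\<close> differ by a constant.  Such a function has
  order exactly the number of its exponential terms (\<open>simple_of_order_exp_poly_sum\<close>).  The sum has
  the exponents \<open>x ^ k\<close> with \<open>1 \<le> k \<le> n\<close>; the square has the exponents
  \<open>x ^ i + x ^ j\<close> with \<open>1 \<le> i \<le> j \<le> n\<close>, and there are \<open>n * (n + 1) div 2\<close> of these.

  Differentiating \<open>f\<close> replaces each \<open>u j\<close> by \<open>u j' + q j' * u j\<close>, the twisted derivative of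
  \<open>u j\<close>.  Since exponentials of polynomials that do not differ by constants are linearly
  independent over the polynomials, \<open>f\<close> solves the equation with coefficients \<open>p k\<close>
  if and only if, for each \<open>j\<close>, the \<open>p k\<close> are a linear relation between the iterated twisted
  derivatives of \<open>u j\<close> (\<open>solves_diff_eq_exp_poly_sum_iff\<close>).  The order is thus a question about
  linear algebra over a polynomial ring.

  Upper bound: a relation of length \<open>card I\<close> is a nontrivial solution of \<open>card I\<close> homogeneous
  linear equations in \<open>card I + 1\<close> unknowns.  Elimination without division
  (\<open>homogeneous_system_nontrivial_solution\<close>) keeps its coefficients in \<open>K\<close>.

  Lower bound (\<open>twist_iterates_relation_length\<close>): given a relation of order \<open>N < card I\<close>, consider
  the families of polynomials orthogonal to the first \<open>N\<close> iterates.  There are nonzero ones, by the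
  same linear algebra, and the relation makes the set of all of them stable under the dual twisted
  derivation.  A stable set of this kind must contain a family with a single nonzero entry
  (\<open>twist_closed_contains_singleton_support\<close>), which cannot be orthogonal to the zeroth
  iterate \<open>u\<close>.  The lemma on stable sets also gives the linear independence of the exponentials.
\<close>

section \<open>Subrings and homogeneous linear systems\<close>

definition is_subring :: "'a::comm_ring_1 set \<Rightarrow> bool"
  where "is_subring R \<longleftrightarrow> 1 \<in> R \<and> (\<forall>a\<in>R. \<forall>b\<in>R. a - b \<in> R \<and> a * b \<in> R)"

lemma is_subringD:
  assumes "is_subring R"
  shows "1 \<in> R" "0 \<in> R" "a \<in> R \<Longrightarrow> b \<in> R \<Longrightarrow> a - b \<in> R"
    "a \<in> R \<Longrightarrow> b \<in> R \<Longrightarrow> a * b \<in> R" "a \<in> R \<Longrightarrow> - a \<in> R"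
    "a \<in> R \<Longrightarrow> b \<in> R \<Longrightarrow> a + b \<in> R"
proof -
  note closed = assms[unfolded is_subring_def]
  show one: "1 \<in> R" using closed by blast
  show diff: "a - b \<in> R" if "a \<in> R" "b \<in> R" for a b using closed that by blast
  show "a * b \<in> R" if "a \<in> R" "b \<in> R" using closed that by blast
  show zero: "0 \<in> R" using diff[OF one one] by simp
  show neg: "- a \<in> R" if "a \<in> R" for a using diff[OF zero that] by simp
  show "a + b \<in> R" if "a \<in> R" "b \<in> R" using diff[OF that(1) neg[OF that(2)]] by simp
qed

lemma is_subring_sum:
  assumes "is_subring R" "\<And>i. i \<in> I \<Longrightarrow> f i \<in> R"
  shows "sum f I \<in> R"
  using assms(2)
  by (induction I rule: infinite_finite_induct) (auto intro: is_subringD[OF assms(1)])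

lemma is_subring_of_nat:
  assumes "is_subring R"
  shows "of_nat k \<in> R"
  by (induction k) (auto intro: is_subringD[OF assms])

lemma is_subring_coeffs:
  fixes K :: "'a::comm_ring_1 set"
  assumes "is_subring K"
  shows "is_subring {p. \<forall>i. coeff p i \<in> K}"
  unfolding is_subring_def
  by (auto simp: coeff_mult one_pCons coeff_pCons split: nat.split
      intro!: is_subring_sum[OF assms] intro: is_subringD[OF assms])

text \<open>
  Gaussian elimination by cross multiplication: no division occurs, so if the matrix has its entries
  in a subring, there is a nontrivial solution with entries in that subring.
\<close>

lemma homogeneous_system_nontrivial_solution:
  fixes A :: "'e \<Rightarrow> 'u \<Rightarrow> 'a::idom"
  assumes R: "is_subring R" and "finite E" "finite U" "card E < card U"
    and "\<And>e u. e \<in> E \<Longrightarrow> u \<in> U \<Longrightarrow> A e u \<in> R"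
  shows "\<exists>x. (\<forall>u\<in>U. x u \<in> R) \<and> (\<exists>u\<in>U. x u \<noteq> 0) \<and> (\<forall>e\<in>E. (\<Sum>u\<in>U. A e u * x u) = 0)"
  using assms(2-)
proof (induction E arbitrary: U A rule: finite_induct)
  case empty
  then have "U \<noteq> {}" by auto
  then show ?case by (intro exI[of _ "\<lambda>_. 1"]) (auto intro: is_subringD[OF R])
next
  case (insert e E)
  show ?case
  proof (cases "\<forall>u\<in>U. A e u = 0")
    case True
    have "\<exists>x. (\<forall>u\<in>U. x u \<in> R) \<and> (\<exists>u\<in>U. x u \<noteq> 0) \<and> (\<forall>e\<in>E. (\<Sum>u\<in>U. A e u * x u) = 0)"
      using insert by (intro insert.IH) auto
    then show ?thesis using True by auto
  next
    case False
    then obtain v where v: "v \<in> U" "A e v \<noteq> 0" by blast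
    define V where "V = U - {v}"
    have V: "finite V" "U = insert v V" "v \<notin> V"
      using v insert.prems(1) by (auto simp: V_def)
    \<comment> \<open>The row \<open>e'\<close> with the unknown \<open>v\<close> eliminated by means of the row \<open>e\<close>.\<close>
    define B where "B e' u = A e v * A e' u - A e' v * A e u" for e' u
    have "\<exists>x. (\<forall>u\<in>V. x u \<in> R) \<and> (\<exists>u\<in>V. x u \<noteq> 0) \<and> (\<forall>e'\<in>E. (\<Sum>u\<in>V. B e' u * x u) = 0)"
      using V insert by (intro insert.IH) (auto simp: B_def intro!: is_subringD[OF R])
    then obtain x where x: "\<forall>u\<in>V. x u \<in> R" "\<exists>u\<in>V. x u \<noteq> 0"
      "\<And>e'. e' \<in> E \<Longrightarrow> (\<Sum>u\<in>V. B e' u * x u) = 0" by blast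
    define z where "z u = (if u = v then - (\<Sum>w\<in>V. A e w * x w) else A e v * x u)" for u
    have row: "(\<Sum>u\<in>U. A e' u * z u) = (\<Sum>u\<in>V. B e' u * x u)" for e'
    proof -
      have "(\<Sum>u\<in>U. A e' u * z u) = A e' v * z v + (\<Sum>u\<in>V. A e' u * z u)"
        using V by simp
      also have "(\<Sum>u\<in>V. A e' u * z u) = (\<Sum>u\<in>V. A e' u * (A e v * x u))"
        using V(3) by (intro sum.cong) (auto simp: z_def)
      finally show ?thesis
        by (simp add: B_def z_def sum_distrib_left sum_subtractf algebra_simps)
    qed
    have "\<forall>u\<in>U. z u \<in> R"
      using x(1) V insert.prems(3)
      by (auto simp: z_def intro!: is_subringD[OF R] is_subring_sum[OF R])
    moreover have "\<exists>u\<in>U. z u \<noteq> 0"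
      using x(2) V v(2) by (auto simp: z_def)
    moreover have "(\<Sum>u\<in>U. A e' u * z u) = 0" if "e' \<in> insert e E" for e'
    proof (cases "e' = e")
      case True
      then show ?thesis unfolding row by (simp add: B_def)
    next
      case False
      then show ?thesis using that x(3) unfolding row by simp
    qed
    ultimately show ?thesis by blast
  qed
qed

section \<open>Twisted derivations on families of polynomials\<close>

text \<open>
  If \<open>d j\<close> is the derivative of \<open>q j\<close>, then \<open>twist d\<close> describes the effect of differentiating
  \<open>(\<Sum>j\<in>I. y j * exp (q j))\<close> on the coefficients \<open>y j\<close>.
\<close>

definition twist :: "('i \<Rightarrow> 'a::idom poly) \<Rightarrow> ('i \<Rightarrow> 'a poly) \<Rightarrow> 'i \<Rightarrow> 'a poly"
  where "twist d y j = pderiv (y j) + d j * y j"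

lemma degree_pderiv_less:
  fixes p :: "'a::idom poly"
  assumes "degree p \<noteq> 0"
  shows "degree (pderiv p) < degree p"
proof -
  have "degree (pderiv p) \<le> degree p - 1"
    by (intro degree_le) (auto simp: coeff_pderiv coeff_eq_0 simp del: of_nat_Suc)
  then show ?thesis using assms by simp
qed

text \<open>
  Dividing by \<open>f * g\<close> turns the hypothesis into the statement that the logarithmic derivative of
  \<open>g / f\<close> is the polynomial \<open>h\<close>.  A logarithmic derivative of a rational function vanishes at
  infinity, so \<open>h\<close> must be zero; in polynomial terms, the left-hand side has too small a degree.
\<close>

lemma wronskian_eq_multiple_of_product:
  fixes f g h :: "'a::idom poly"
  assumes "f * pderiv g - pderiv f * g = h * (f * g)" "f \<noteq> 0" "g \<noteq> 0"
  shows "h = 0"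
proof (rule ccontr)
  assume "h \<noteq> 0"
  define m where "m = degree f + degree g"
  have deg: "degree (f * pderiv g - pderiv f * g) = degree h + m"
    using assms \<open>h \<noteq> 0\<close> by (simp add: degree_mult_eq m_def)
  have drop: "degree (a * pderiv b) \<le> degree a + degree b - 1" for a b :: "'a poly"
  proof (cases "degree b = 0")
    case True
    then have "pderiv b = 0" by (auto simp: pderiv.simps elim!: degree_eq_zeroE)
    then show ?thesis by simp
  next
    case False
    then show ?thesis
      using degree_mult_le[of a "pderiv b"] degree_pderiv_less[of b] by linarith
  qed
  have "degree (f * pderiv g - pderiv f * g) \<le> m - 1"
    using drop[of f g] drop[of g f]
    by (intro degree_diff_le) (simp_all add: m_def mult.commute add.commute)
  then have "m = 0" using deg by simp
  then have "pderiv f = 0" "pderiv g = 0"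
    by (auto simp: m_def pderiv.simps elim!: degree_eq_zeroE)
  then show False using assms \<open>h \<noteq> 0\<close> by simp
qed

text \<open>
  In a nonzero family \<open>y\<close> of minimal support, the entry at an index \<open>i\<close> can be cancelled by
  combining \<open>y\<close> with its twisted derivative.  By minimality the combination is zero everywhere,
  which at any other index \<open>j\<close> of the support means that the Wronskian of \<open>y i\<close> and \<open>y j\<close> is
  \<open>(d i - d j) * (y i * y j)\<close>.  As \<open>d i \<noteq> d j\<close>, there is no such \<open>j\<close>.
\<close>

lemma twist_closed_contains_singleton_support:
  fixes Y :: "('i \<Rightarrow> 'a::idom poly) set" and d :: "'i \<Rightarrow> 'a poly"
  assumes "finite I" "inj_on d I"
    and twist: "\<And>y. y \<in> Y \<Longrightarrow> twist d y \<in> Y"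
    and comb: "\<And>a b y z. y \<in> Y \<Longrightarrow> z \<in> Y \<Longrightarrow> (\<lambda>j. a * y j - b * z j) \<in> Y"
    and "y0 \<in> Y" "\<exists>j\<in>I. y0 j \<noteq> 0"
  shows "\<exists>y\<in>Y. \<exists>i\<in>I. y i \<noteq> 0 \<and> (\<forall>j\<in>I - {i}. y j = 0)"
proof -
  define supp where "supp y = {j \<in> I. y j \<noteq> 0}" for y :: "'i \<Rightarrow> 'a poly"
  have fin: "finite (supp y)" for y using assms(1) by (simp add: supp_def)
  have "y0 \<in> Y \<and> supp y0 \<noteq> {}" using assms(5,6) by (auto simp: supp_def)
  from ex_has_least_nat[of "\<lambda>y. y \<in> Y \<and> supp y \<noteq> {}", OF this, of "\<lambda>y. card (supp y)"]
  obtain y where y: "y \<in> Y" "supp y \<noteq> {}"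
    and least: "\<And>z. z \<in> Y \<Longrightarrow> supp z \<noteq> {} \<Longrightarrow> card (supp y) \<le> card (supp z)"
    by blast
  obtain i where i: "i \<in> I" "y i \<noteq> 0" using y(2) by (auto simp: supp_def)
  define z where "z = (\<lambda>j. y i * twist d y j - twist d y i * y j)"
  have "z \<in> Y" unfolding z_def by (intro comb twist y)
  moreover have "supp z \<subseteq> supp y" by (auto simp: supp_def z_def twist_def)
  moreover have "i \<in> supp y" "i \<notin> supp z" using i by (auto simp: supp_def z_def)
  ultimately have "card (supp z) < card (supp y)" by (intro psubset_card_mono fin) blast
  with \<open>z \<in> Y\<close> have "supp z = {}" using least[of z] by fastforce
  then have z0: "z j = 0" if "j \<in> I" for j using that by (auto simp: supp_def)
  have "y j = 0" if j: "j \<in> I - {i}" for j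
  proof (rule ccontr)
    assume "y j \<noteq> 0"
    have "y i * pderiv (y j) - pderiv (y i) * y j = (d i - d j) * (y i * y j)"
      using z0[of j] j by (simp add: z_def twist_def algebra_simps)
    then have "d i - d j = 0"
      using i(2) \<open>y j \<noteq> 0\<close> by (rule wronskian_eq_multiple_of_product)
    then show False using inj_onD[OF assms(2), of i j] i(1) j by auto
  qed
  then show ?thesis using y(1) i by blast
qed

text \<open>
  The twists by \<open>d\<close> and by \<open>- d\<close> are dual to each other, because \<open>exp (- q j)\<close> and \<open>exp (q j)\<close>
  cancel in the product of \<open>y j * exp (- q j)\<close> and \<open>w j * exp (q j)\<close>.
\<close>

lemma pderiv_twist_pairing:
  "pderiv (\<Sum>j\<in>I. y j * w j) =
    (\<Sum>j\<in>I. twist (\<lambda>j. - d j) y j * w j) + (\<Sum>j\<in>I. y j * twist d w j)"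
proof -
  have "pderiv (y j * w j) = twist (\<lambda>j. - d j) y j * w j + y j * twist d w j" for j
    by (simp add: twist_def pderiv_mult algebra_simps)
  then show ?thesis
    using higher_pderiv_sum[of 1 "\<lambda>j. y j * w j" I] by (simp add: sum.distrib)
qed

text \<open>
  This is the lower bound for the order, an algebraic substitute for the theorem that an equation of
  order \<open>N\<close> has at most \<open>N\<close> linearly independent solutions.  If \<open>N\<close> were smaller than
  \<open>card I\<close>, the orthogonal complement \<open>Y\<close> of the first \<open>N\<close> iterates would be nonzero.  The
  relation shows that \<open>Y\<close> is orthogonal to the iterate number \<open>N\<close> as well (its coefficient \<open>p N\<close>
  can be cancelled), so \<open>Y\<close> is stable under the dual twist and contains a family supported at
  one index, in contradiction to the orthogonality to \<open>w\<close>.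
\<close>

lemma twist_iterates_relation_length:
  fixes w :: "'i \<Rightarrow> 'a::idom poly"
  assumes I: "finite I" and inj: "inj_on d I" and w0: "\<And>j. j \<in> I \<Longrightarrow> w j \<noteq> 0"
    and pN: "p N \<noteq> 0"
    and rel: "\<And>j. j \<in> I \<Longrightarrow> (\<Sum>k\<le>N. p k * (twist d ^^ k) w j) = 0"
  shows "card I \<le> N"
proof (rule ccontr)
  assume "\<not> card I \<le> N"
  then have card: "card {..<N} < card I" by simp
  define Y where "Y = {y. \<forall>k<N. (\<Sum>j\<in>I. y j * (twist d ^^ k) w j) = 0}"
  have "is_subring (UNIV :: 'a poly set)" by (simp add: is_subring_def)
  from homogeneous_system_nontrivial_solution
      [OF this _ I card, of "\<lambda>k j. (twist d ^^ k) w j"]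
  obtain y0 where "y0 \<in> Y" "\<exists>j\<in>I. y0 j \<noteq> 0"
    by (auto simp: Y_def mult.commute)
  moreover have "twist (\<lambda>j. - d j) y \<in> Y" if "y \<in> Y" for y
  proof -
    define S where "S k = (\<Sum>j\<in>I. y j * (twist d ^^ k) w j)" for k
    have S0: "S k = 0" if "k < N" for k using that \<open>y \<in> Y\<close> by (simp add: Y_def S_def)
    have "(\<Sum>k\<le>N. p k * S k) = (\<Sum>j\<in>I. y j * (\<Sum>k\<le>N. p k * (twist d ^^ k) w j))"
      unfolding S_def sum_distrib_left by (subst sum.swap) (simp add: algebra_simps)
    also have "\<dots> = 0" using rel by simp
    finally have "(\<Sum>k\<le>N. p k * S k) = 0" .
    moreover have "(\<Sum>k\<le>N. p k * S k) = p N * S N"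
      using S0 by (simp add: lessThan_Suc_atMost[symmetric])
    ultimately have "S N = 0" using pN by simp
    then have S: "S k = 0" if "k \<le> N" for k using that S0 by (cases "k = N") auto
    have "(\<Sum>j\<in>I. twist (\<lambda>j. - d j) y j * (twist d ^^ k) w j) = pderiv (S k) - S (Suc k)" for k
      unfolding S_def pderiv_twist_pairing[of y _ I d] by simp
    then show ?thesis using S by (simp add: Y_def)
  qed
  moreover have "(\<lambda>j. a * y j - b * z j) \<in> Y" if "y \<in> Y" "z \<in> Y" for a b y z
    using that by (simp add: Y_def left_diff_distrib sum_subtractf mult.assoc
        flip: sum_distrib_left)
  moreover have "inj_on (\<lambda>j. - d j) I" using inj by (simp add: inj_on_def)
  ultimately obtain y i where y: "y \<in> Y" "i \<in> I" "y i \<noteq> 0" "\<forall>j\<in>I - {i}. y j = 0"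
    using twist_closed_contains_singleton_support[OF I, of "\<lambda>j. - d j" Y y0] by blast
  \<comment> \<open>Orthogonality to \<open>w\<close> itself is among the conditions that define \<open>Y\<close> only if \<open>N > 0\<close>.\<close>
  have "N \<noteq> 0" using rel[OF y(2)] pN w0[OF y(2)] by (cases N) auto
  then have "(\<Sum>j\<in>I. y j * w j) = 0" using y(1) by (force simp: Y_def)
  then have "y i * w i = 0" using y(4) by (simp add: sum.remove[OF I y(2)])
  then show False using y(3) w0[OF y(2)] by simp
qed

section \<open>Exponential polynomials\<close>

definition exp_poly_sum ::
    "'i set \<Rightarrow> ('i \<Rightarrow> 'a poly) \<Rightarrow> ('i \<Rightarrow> 'a poly) \<Rightarrow> 'a::{real_normed_field,banach} \<Rightarrow> 'a"
  where "exp_poly_sum I q u x = (\<Sum>j\<in>I. poly (u j) x * exp (poly (q j) x))"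

lemma exp_poly_sum_has_derivative:
  "(exp_poly_sum I q u has_field_derivative exp_poly_sum I q (twist (\<lambda>j. pderiv (q j)) u) x) (at x)"
proof -
  have "((\<lambda>x. poly (u j) x * exp (poly (q j) x)) has_field_derivative
      poly (twist (\<lambda>j. pderiv (q j)) u j) x * exp (poly (q j) x)) (at x)" for j
    by (rule derivative_eq_intros refl poly_DERIV)+ (simp add: twist_def algebra_simps)
  then show ?thesis unfolding exp_poly_sum_def by (intro DERIV_sum)
qed

lemma higher_deriv_exp_poly_sum:
  "(deriv ^^ k) (exp_poly_sum I q u) = exp_poly_sum I q ((twist (\<lambda>j. pderiv (q j)) ^^ k) u)"
  by (induction k) (auto intro!: ext DERIV_imp_deriv exp_poly_sum_has_derivative)

text \<open>
  Linear independence of the exponentials over the polynomials: the coefficient families of the zero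
  function are closed under the twist, since its derivative is zero too.  If there were a
  nonzero one, there would be one with a single nonzero entry, but a single term
  \<open>poly (y i) x * exp (poly (q i) x)\<close> vanishes identically only if \<open>y i = 0\<close>.
\<close>

lemma exp_poly_sum_eq_0_iff:
  fixes q :: "'i \<Rightarrow> 'a::{real_normed_field,banach} poly"
  assumes I: "finite I" and inj: "inj_on (\<lambda>j. pderiv (q j)) I"
  shows "(\<forall>x. exp_poly_sum I q u x = 0) \<longleftrightarrow> (\<forall>j\<in>I. u j = 0)"
proof
  define Y where "Y = {u. \<forall>x. exp_poly_sum I q u x = 0}"
  assume "\<forall>x. exp_poly_sum I q u x = 0"
  then have u: "u \<in> Y" by (simp add: Y_def)
  have "twist (\<lambda>j. pderiv (q j)) y \<in> Y" if "y \<in> Y" for y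
  proof -
    have "exp_poly_sum I q y = (\<lambda>x. 0)" using that by (auto simp: Y_def)
    then show ?thesis
      using DERIV_unique[OF _ DERIV_const] exp_poly_sum_has_derivative[of I q y]
      by (auto simp: Y_def)
  qed
  moreover have "(\<lambda>j. a * y j - b * z j) \<in> Y" if "y \<in> Y" "z \<in> Y" for a b y z
  proof -
    have "exp_poly_sum I q (\<lambda>j. a * y j - b * z j) x
        = poly a x * exp_poly_sum I q y x - poly b x * exp_poly_sum I q z x" for x
      by (simp add: exp_poly_sum_def sum_distrib_left sum_subtractf algebra_simps)
    then show ?thesis using that by (simp add: Y_def)
  qed
  moreover have False if "y \<in> Y" "i \<in> I" "y i \<noteq> 0" "\<forall>j\<in>I - {i}. y j = 0" for y i
  proof -
    have "exp_poly_sum I q y x = poly (y i) x * exp (poly (q i) x)" for x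
      using that(4) by (simp add: exp_poly_sum_def sum.remove[OF I that(2)])
    then have "poly (y i) x = 0" for x using that(1) by (simp add: Y_def)
    then show False using that(3) poly_all_0_iff_0 by blast
  qed
  ultimately show "\<forall>j\<in>I. u j = 0"
    using twist_closed_contains_singleton_support[OF I inj, of Y u] u by blast
qed (simp add: exp_poly_sum_def)

lemma solves_diff_eq_exp_poly_sum_iff:
  fixes q :: "'i \<Rightarrow> 'a::{real_normed_field,banach} poly"
  assumes "finite I" "inj_on (\<lambda>j. pderiv (q j)) I"
  shows "solves_diff_eq UNIV (exp_poly_sum I q u) N p \<longleftrightarrow>
    (\<forall>j\<in>I. (\<Sum>k\<le>N. p k * (twist (\<lambda>j. pderiv (q j)) ^^ k) u j) = 0)"
proof -
  have "(\<Sum>k\<le>N. poly (p k) x * (deriv ^^ k) (exp_poly_sum I q u) x)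
      = exp_poly_sum I q (\<lambda>j. \<Sum>k\<le>N. p k * (twist (\<lambda>j. pderiv (q j)) ^^ k) u j) x" for x
    unfolding higher_deriv_exp_poly_sum exp_poly_sum_def sum_distrib_left poly_sum sum_distrib_right
    by (subst sum.swap) (simp add: mult.assoc)
  moreover have "(deriv ^^ k) (exp_poly_sum I q u) field_differentiable at x" for k x
    unfolding higher_deriv_exp_poly_sum field_differentiable_def
    using exp_poly_sum_has_derivative by blast
  ultimately show ?thesis
    unfolding solves_diff_eq_def exp_poly_sum_eq_0_iff[OF assms, symmetric] by simp
qed

text \<open>
  The linear system for the coefficients of a differential equation has one equation for each index
  in \<open>I\<close> and \<open>card I + 1\<close> unknowns.  Its solution might end in zeros, so it only provides an
  equation of some order \<open>N \<le> card I\<close>; the lower bound excludes \<open>N < card I\<close>.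
\<close>

theorem simple_of_order_exp_poly_sum:
  fixes q :: "'i \<Rightarrow> 'a::{real_normed_field,banach} poly"
  assumes K: "is_subring K" and I: "finite I" and inj: "inj_on (\<lambda>j. pderiv (q j)) I"
    and qK: "\<And>j i. j \<in> I \<Longrightarrow> coeff (q j) i \<in> K"
    and uK: "\<And>j i. j \<in> I \<Longrightarrow> coeff (u j) i \<in> K"
    and u0: "\<And>j. j \<in> I \<Longrightarrow> u j \<noteq> 0"
  shows "simple_of_order K UNIV (exp_poly_sum I q u) (card I)"
proof -
  define d where "d = (\<lambda>j. pderiv (q j))"
  define R where "R = {p :: 'a poly. \<forall>i. coeff p i \<in> K}"
  have R: "is_subring R" unfolding R_def by (rule is_subring_coeffs[OF K])
  have pderivR: "pderiv p \<in> R" if "p \<in> R" for p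
    using that is_subring_of_nat[OF K]
    by (auto simp: R_def coeff_pderiv simp del: of_nat_Suc intro!: is_subringD[OF K])
  have wR: "(twist d ^^ k) u j \<in> R" if "j \<in> I" for j k
  proof (induction k)
    case 0
    then show ?case using uK that by (simp add: R_def)
  next
    case (Suc k)
    have "q j \<in> R" using qK that by (simp add: R_def)
    then show ?case using Suc by (auto simp: twist_def d_def intro!: is_subringD[OF R] pderivR)
  qed
  have lower: "card I \<le> N" if "satisfies_simple_of_order K UNIV (exp_poly_sum I q u) N" for N
  proof -
    from that obtain p where "p N \<noteq> 0" "solves_diff_eq UNIV (exp_poly_sum I q u) N p"
      by (auto simp: satisfies_simple_of_order_def simple_diff_eq_def)
    then show ?thesis
      unfolding solves_diff_eq_exp_poly_sum_iff[OF I inj]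
      using twist_iterates_relation_length[of I "\<lambda>j. pderiv (q j)" u p N] I inj u0 by blast
  qed
  obtain N where N: "N \<le> card I" "satisfies_simple_of_order K UNIV (exp_poly_sum I q u) N"
  proof -
    have "card I < card {..card I}" by simp
    from homogeneous_system_nontrivial_solution
        [OF R I _ this, of "\<lambda>j k. (twist d ^^ k) u j"]
    obtain p where p: "\<forall>k\<le>card I. p k \<in> R" "\<exists>k\<le>card I. p k \<noteq> 0"
      "\<forall>j\<in>I. (\<Sum>k\<le>card I. (twist d ^^ k) u j * p k) = 0"
      using wR by (auto simp: Bex_def)
    define N where "N = (GREATEST k. k \<le> card I \<and> p k \<noteq> 0)"
    have N: "N \<le> card I" "p N \<noteq> 0"
      using GreatestI_ex_nat[of "\<lambda>k. k \<le> card I \<and> p k \<noteq> 0" "card I"] p(2)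
      by (auto simp: N_def)
    have beyond: "p k = 0" if "k \<le> card I" "k > N" for k
      using Greatest_le_nat[of "\<lambda>k. k \<le> card I \<and> p k \<noteq> 0" k "card I"] that
      by (auto simp: N_def)
    have "(\<Sum>k\<le>N. p k * (twist d ^^ k) u j) = (\<Sum>k\<le>card I. p k * (twist d ^^ k) u j)" for j
      using N(1) beyond by (intro sum.mono_neutral_left) auto
    then have "solves_diff_eq UNIV (exp_poly_sum I q u) N p"
      unfolding solves_diff_eq_exp_poly_sum_iff[OF I inj]
      using p(3) by (simp add: d_def mult.commute)
    moreover have "simple_diff_eq K N p"
      using p(1) N by (auto simp: simple_diff_eq_def R_def)
    ultimately show ?thesis
      using that[of N] N(1) by (auto simp: satisfies_simple_of_order_def)
  qed
  have "simple_order K UNIV (exp_poly_sum I q u) = card I"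
    unfolding simple_order_def using N lower by (intro Least_equality) (auto dest: le_antisym)
  then show ?thesis
    using N(2) by (auto simp: simple_of_order_def simple_fun_def)
qed

section \<open>The sum of the exponentials of powers and its square\<close>

lemma pderiv_eq_imp_eq:
  fixes p q :: "'a::{idom,ring_char_0} poly"
  assumes "pderiv p = pderiv q" "coeff p 0 = coeff q 0"
  shows "p = q"
proof -
  have "pderiv (p - q) = 0" using assms(1) by (simp add: pderiv_diff)
  then obtain c where "p - q = [:c:]" by (auto simp: pderiv_eq_0_iff elim: degree_eq_zeroE)
  then show ?thesis using assms(2) by (metis coeff_diff coeff_pCons_0 eq_iff_diff_eq_0 pCons_0_0)
qed

lemma simple_of_order_exp_power_sum:
  fixes K :: "'a::{real_normed_field,banach} set"
  assumes "is_subring K"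
  shows "simple_of_order K UNIV (exp_power_sum n) n"
proof -
  have "exp_power_sum n = exp_poly_sum {1..n} (monom (1::'a)) (\<lambda>_. 1)"
    by (simp add: exp_power_sum_def exp_poly_sum_def poly_monom fun_eq_iff)
  moreover have "inj_on (\<lambda>k. pderiv (monom (1::'a) k)) {1..n}"
    by (intro inj_onI) (auto dest!: pderiv_eq_imp_eq simp: monom_eq_iff')
  moreover have "(1::'a poly) \<in> {p. \<forall>i. coeff p i \<in> K}"
    by (intro is_subringD is_subring_coeffs assms)
  ultimately show ?thesis
    using simple_of_order_exp_poly_sum[OF assms, of "{1..n}" "monom 1" "\<lambda>_. 1"]
      is_subringD(1,2)[OF assms] by simp
qed

text \<open>
  The exponents can be read off as the positions of the nonzero coefficients.  For \<open>i = j\<close> the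
  only such coefficient is 2, which would be lost in characteristic two.
\<close>

lemma monom_add_monom_eq_iff:
  fixes i j a b :: nat
  assumes "monom (1::'a::{comm_semiring_1,semiring_char_0}) i + monom 1 j = monom 1 a + monom 1 b"
    "i \<le> j" "a \<le> b"
  shows "i = a \<and> j = b"
proof -
  have "(if i = k then 1 else 0) + (if j = k then 1 else 0)
      = (if a = k then 1 else 0) + (if b = k then (1::'a) else 0)" for k
    using arg_cong[OF assms(1), of "\<lambda>p. coeff p k"] by simp
  from this[of i] this[of j] this[of a] this[of b] assms(2,3) show ?thesis
    by (auto split: if_splits)
qed

text \<open>
  Collecting equal terms in the square leaves one term for each unordered pair of exponents, with
  coefficient 1 on the diagonal and 2 elsewhere.
\<close>

lemma simple_of_order_exp_power_sum_square:
  fixes K :: "'a::{real_normed_field,banach} set"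
  assumes "is_subring K"
  shows "simple_of_order K UNIV (\<lambda>x. (exp_power_sum n x)^2) (n * (n + 1) div 2)"
proof -
  define I where "I = (SIGMA j:{1..n}. {1..j})"
  define q where "q = (\<lambda>(j, i). monom (1::'a) i + monom 1 j)"
  define u :: "nat \<times> nat \<Rightarrow> 'a poly" where "u = (\<lambda>(j, i). if i = j then 1 else 2)"
  have I: "finite I" by (simp add: I_def)
  have "card I = \<Sum>{1..n}" by (simp add: I_def)
  then have card: "card I = n * (n + 1) div 2" by (simp add: Sum_Icc_nat)
  have square: "(\<lambda>x. (exp_power_sum n x)^2) = exp_poly_sum I q u"
  proof
    fix x :: 'a
    define e where "e k = exp (x ^ k)" for k :: nat
    have "(\<Sum>k=1..m. e k)^2 = (\<Sum>j=1..m. \<Sum>i=1..j. (if i = j then 1 else 2) * (e i * e j))" for m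
    proof (induction m)
      case (Suc m)
      have "(\<Sum>i=1..m. (if i = Suc m then 1 else 2) * (e i * e (Suc m)))
          = 2 * (\<Sum>k=1..m. e k) * e (Suc m)"
        by (simp add: sum_distrib_left sum_distrib_right mult.assoc)
      then show ?case using Suc by (simp add: power2_eq_square algebra_simps)
    qed simp
    then have "(exp_power_sum n x)^2 = (\<Sum>(j, i)\<in>I. (if i = j then 1 else 2) * (e i * e j))"
      by (simp add: exp_power_sum_def e_def I_def sum.Sigma)
    also have "\<dots> = exp_poly_sum I q u x"
      by (auto intro!: sum.cong simp: exp_poly_sum_def q_def u_def e_def poly_monom exp_add)
    finally show "(exp_power_sum n x)^2 = exp_poly_sum I q u x" .
  qed
  have "inj_on (\<lambda>s. pderiv (q s)) I"
    by (intro inj_onI) (auto simp: I_def q_def dest!: pderiv_eq_imp_eq monom_add_monom_eq_iff)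
  moreover have "q s \<in> {p. \<forall>i. coeff p i \<in> K}" for s
    using is_subringD[OF assms] by (auto simp: q_def split: prod.split)
  moreover have "u s \<in> {p. \<forall>i. coeff p i \<in> K}" for s
    using is_subring_of_nat[OF is_subring_coeffs[OF assms], of 1]
      is_subring_of_nat[OF is_subring_coeffs[OF assms], of 2]
    by (simp add: u_def split: prod.split)
  moreover have "u s \<noteq> 0" for s by (simp add: u_def split: prod.split)
  ultimately show ?thesis
    unfolding square card[symmetric] using simple_of_order_exp_poly_sum[OF assms I, of q u] by simp
qed

theorem theorem4:
  fixes n :: nat
  assumes "n \<ge> 1"
  shows
    "(\<forall>K \<in> {\<rat>, UNIV :: real set}.
        (\<exists>f :: real \<Rightarrow> real. simple_of_order K UNIV f n \<and>
             simple_of_order K UNIV (\<lambda>x. (f x)^2) (n * (n + 1) div 2)) \<and>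
        simple_of_order K UNIV (exp_power_sum n) n \<and>
        simple_of_order K UNIV (\<lambda>x. (exp_power_sum n x)^2) (n * (n + 1) div 2)) \<and>
     (\<forall>K \<in> {\<rat>, \<real>, UNIV :: complex set}.
        (\<exists>f :: complex \<Rightarrow> complex. simple_of_order K UNIV f n \<and>
             simple_of_order K UNIV (\<lambda>x. (f x)^2) (n * (n + 1) div 2)) \<and>
        simple_of_order K UNIV (exp_power_sum n) n \<and>
        simple_of_order K UNIV (\<lambda>x. (exp_power_sum n x)^2) (n * (n + 1) div 2))"
proof -
  have all: "(\<exists>f. simple_of_order K UNIV f n \<and>
             simple_of_order K UNIV (\<lambda>x. (f x)^2) (n * (n + 1) div 2)) \<and>
        simple_of_order K UNIV (exp_power_sum n) n \<and>
        simple_of_order K UNIV (\<lambda>x. (exp_power_sum n x)^2) (n * (n + 1) div 2)"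
    if "is_subring K" for K :: "'a::{real_normed_field,banach} set"
    using simple_of_order_exp_power_sum[OF that] simple_of_order_exp_power_sum_square[OF that]
    by (intro conjI exI[of _ "exp_power_sum n"])
  have "is_subring K" if "K \<in> {\<rat>, UNIV :: real set}" for K
    using that by (auto simp: is_subring_def)
  moreover have "is_subring K" if "K \<in> {\<rat>, \<real>, UNIV :: complex set}" for K
    using that by (auto simp: is_subring_def)
  ultimately show ?thesis by (intro conjI[OF ballI ballI] all)
qed

end
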